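(* For $0<\alpha<1$ let $h_\alpha$ be the density of Kanter's random variable $a_\alpha(U)$, where $U$ is uniformly distributed on $(0,\pi)$; $h_\alpha$ is supported by $((1-\alpha)\alpha^{\alpha/(1-\alpha)},\infty)$. Then for every fixed $y>1$, $$\lim_{\alpha\to0^+}h_\alpha(y)=0.$$
   Context: For $0<\alpha<1$ and $u\in(0,\pi)$ put $c_\alpha(u)=\frac{\sin(\alpha u)}{\sin u}$, $b_\alpha(u)=[c_\alpha(u)]^{\alpha}[c_{1-\alpha}(u)]^{1-\alpha}$ and $a_\alpha(u)=[b_\alpha(u)]^{1/(1-\alpha)}$. The function $a_\alpha$ is a strictly increasing bijection from $(0,\pi)$ onto $(a_\alpha(0),\infty)$ with $a_\alpha(0)=(1-\alpha)\alpha^{\alpha/(1-\alpha)}$, and $h_\alpha$ denotes the continuous version on $(a_\alpha(0),\infty)$ of the density of $a_\alpha(U)$, that is $h_\alpha(y)=\frac{1}{\pi}\frac{d}{dy}a_\alpha^{-1}(y)$. *)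

theory Defs
  imports "HOL-Probability.Probability"
begin

definition kanter_c :: "real \<Rightarrow> real \<Rightarrow> real" where
  "kanter_c \<alpha> u = sin (\<alpha> * u) / sin u"

definition kanter_b :: "real \<Rightarrow> real \<Rightarrow> real" where
  "kanter_b \<alpha> u = kanter_c \<alpha> u powr \<alpha> * kanter_c (1 - \<alpha>) u powr (1 - \<alpha>)"

definition kanter_a :: "real \<Rightarrow> real \<Rightarrow> real" where
  "kanter_a \<alpha> u = kanter_b \<alpha> u powr (1 / (1 - \<alpha>))"

text \<open>The limit at 0+ of \<^term>\<open>kanter_a \<alpha>\<close>. It gets its own name because \<^term>\<open>kanter_a \<alpha> 0\<close>
  is a division by zero.\<close>

definition kanter_a0 :: "real \<Rightarrow> real" where
  "kanter_a0 \<alpha> = (1 - \<alpha>) * \<alpha> powr (\<alpha> / (1 - \<alpha>))"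

definition kanter_a_inv :: "real \<Rightarrow> real \<Rightarrow> real" where
  "kanter_a_inv \<alpha> = the_inv_into {0<..<pi} (kanter_a \<alpha>)"

text \<open>The continuous version of the density, extended by 0 below \<^term>\<open>kanter_a0 \<alpha>\<close>, where
  \<^const>\<open>the_inv_into\<close> is unspecified.\<close>

definition kanter_h :: "real \<Rightarrow> real \<Rightarrow> real" where
  "kanter_h \<alpha> y = (if kanter_a0 \<alpha> < y then 1 / pi * deriv (kanter_a_inv \<alpha>) y else 0)"

definition uniform_0_pi :: "'a measure \<Rightarrow> ('a \<Rightarrow> real) \<Rightarrow> bool" where
  "uniform_0_pi M U \<longleftrightarrow>
     prob_space M \<and> distributed M lborel U (\<lambda>u. ennreal (indicator {0<..<pi} u / pi))"

end

theory Submission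
  imports Defs "HOL-Real_Asymp.Real_Asymp"
begin

text \<open>Write \<open>\<beta> = 1 - \<alpha>\<close>. The logarithmic derivative of \<open>a\<^sub>\<alpha>\<close> at \<open>u\<close> is
  \<open>(\<alpha>\<^sup>2 cot (\<alpha> u) + \<beta>\<^sup>2 cot (\<beta> u) - cot u) / \<beta>\<close>, which is positive because \<open>x cot x\<close>
  decreases on \<open>(0, \<pi>)\<close>. For \<open>u\<close> near \<open>\<pi>\<close> and \<open>\<alpha>\<close> small it is at least
  \<open>cot (\<beta> u) - cot u \<ge> 1 / sin u - 1 / sin (\<beta> u)\<close>, up to the factor \<open>1 / \<beta>\<close>. If moreover
  \<open>a\<^sub>\<alpha>(u) = y > 1\<close>, then \<open>sin (\<beta> u) / sin u \<ge> y powr \<beta>\<close>, so that the logarithmic derivative is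
  at least \<open>(1 - y powr (- \<beta>)) / sin u\<close>. Since \<open>a\<^sub>\<alpha> \<rightarrow> 1\<close> pointwise as \<open>\<alpha> \<rightarrow> 0\<close>, the solution
  \<open>u\<close> tends to \<open>\<pi>\<close>, the bound explodes, and \<open>h\<^sub>\<alpha>(y)\<close>, which is the reciprocal of
  \<open>\<pi> y\<close> times the logarithmic derivative, vanishes in the limit.\<close>

section \<open>Cotangent facts and the logarithmic derivative\<close>

lemma x_cot_x_strict_antimono:
  fixes x y :: real
  assumes "0 < x" "x < y" "y < pi"
  shows "y * cot y < x * cot x"
proof (rule DERIV_neg_imp_decreasing[of x y "\<lambda>x. x * cot x"])
  show "x < y" by fact
  fix t assume t: "x \<le> t" "t \<le> y"
  then have t0: "0 < t" "t < pi" using assms by auto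
  then have s: "sin t > 0" by (simp add: sin_gt_zero)
  \<comment> \<open>The numerator of the derivative of \<open>x * cot x\<close> is negative since
    sin t cos t < sin t \<le> t.\<close>
  have "cos t < 1" using t0 cos_monotone_0_pi[of 0 t] by simp
  then have "sin t * cos t < sin t * 1" using s by (intro mult_strict_left_mono)
  also have "\<dots> \<le> t" using t0 by (simp add: sin_x_le_x)
  finally have "sin t * cos t - t < 0" by simp
  then have "(sin t * cos t - t) / (sin t)\<^sup>2 < 0"
    using s by (simp add: divide_neg_pos)
  moreover have "((\<lambda>x. x * cot x) has_real_derivative (sin t * cos t - t) / (sin t)\<^sup>2) (at t)"
    using DERIV_mult'[OF DERIV_ident DERIV_cot, of t] s
    by (simp add: cot_def field_simps power2_eq_square)
  ultimately show "\<exists>d. ((\<lambda>x. x * cot x) has_real_derivative d) (at t) \<and> d < 0" by blast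
qed

lemma cot_diff:
  fixes x y :: real
  assumes "sin x \<noteq> 0" "sin y \<noteq> 0"
  shows "cot x - cot y = sin (y - x) / (sin x * sin y)"
  using assms by (simp add: cot_def sin_diff field_simps)

definition kanter_log_deriv :: "real \<Rightarrow> real \<Rightarrow> real" where
  "kanter_log_deriv \<alpha> u =
     (\<alpha>\<^sup>2 * cot (\<alpha> * u) + (1 - \<alpha>)\<^sup>2 * cot ((1 - \<alpha>) * u) - cot u) / (1 - \<alpha>)"

section \<open>The function \<open>kanter_a\<close> for fixed \<alpha>: derivative, monotonicity,
  range\<close>

context
  fixes \<alpha> :: real
  assumes \<alpha>: "0 < \<alpha>" "\<alpha> < 1"
begin

lemma scaled_bounds:
  assumes "0 < u" "u < pi"
  shows "0 < \<alpha> * u" "\<alpha> * u < u" "\<alpha> * u < pi"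
    and "0 < (1 - \<alpha>) * u" "(1 - \<alpha>) * u < u" "(1 - \<alpha>) * u < pi"
proof -
  show a: "0 < \<alpha> * u" "\<alpha> * u < u" "0 < (1 - \<alpha>) * u" "(1 - \<alpha>) * u < u"
    using \<alpha> assms by (auto simp: algebra_simps)
  show "\<alpha> * u < pi" "(1 - \<alpha>) * u < pi"
    using a assms by linarith+
qed

lemma sin_scaled_pos:
  assumes "0 < u" "u < pi"
  shows "sin u > 0" "sin (\<alpha> * u) > 0" "sin ((1 - \<alpha>) * u) > 0"
  using scaled_bounds[OF assms] assms by (auto intro!: sin_gt_zero)

lemma kanter_b_eq:
  assumes "0 < u" "u < pi"
  shows "kanter_b \<alpha> u = sin (\<alpha> * u) powr \<alpha> * sin ((1 - \<alpha>) * u) powr (1 - \<alpha>) / sin u"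
  using sin_scaled_pos[OF assms]
  by (simp add: kanter_b_def kanter_c_def powr_divide powr_diff)

lemma kanter_a_eq_exp:
  assumes "0 < u" "u < pi"
  shows "kanter_a \<alpha> u =
    exp ((\<alpha> * ln (sin (\<alpha> * u)) + (1 - \<alpha>) * ln (sin ((1 - \<alpha>) * u)) - ln (sin u)) / (1 - \<alpha>))"
  using sin_scaled_pos[OF assms]
  by (simp add: kanter_a_def kanter_b_eq[OF assms] powr_def exp_add exp_diff ln_mult ln_div)

text \<open>The exponential form above suits differentiation. This product suits limits: its two
  factors converge separately, both as u tends to 0 and as \<alpha> tends to 0.\<close>

lemma kanter_a_eq_prod:
  assumes "0 < u" "u < pi"
  shows "kanter_a \<alpha> u = kanter_c \<alpha> u powr (\<alpha> / (1 - \<alpha>)) * kanter_c (1 - \<alpha>) u"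
  using sin_scaled_pos[OF assms] \<alpha>
  by (simp add: kanter_a_def kanter_b_def kanter_c_def powr_mult powr_powr)

lemma DERIV_kanter_a:
  assumes u: "0 < u" "u < pi"
  shows "(kanter_a \<alpha> has_real_derivative kanter_a \<alpha> u * kanter_log_deriv \<alpha> u) (at u)"
proof (rule has_field_derivative_transform_within_open[of _ _ _ "{0<..<pi}"])
  let ?L = "\<lambda>u. (\<alpha> * ln (sin (\<alpha> * u)) + (1 - \<alpha>) * ln (sin ((1 - \<alpha>) * u)) - ln (sin u)) / (1 - \<alpha>)"
  have "(?L has_real_derivative
      (\<alpha> * (cos (\<alpha> * u) * \<alpha> / sin (\<alpha> * u)) +
       (1 - \<alpha>) * (cos ((1 - \<alpha>) * u) * (1 - \<alpha>) / sin ((1 - \<alpha>) * u)) - cos u / sin u) / (1 - \<alpha>)) (at u)"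
    using sin_scaled_pos[OF u] by (auto intro!: derivative_eq_intros simp: mult_ac)
  then have "(?L has_real_derivative kanter_log_deriv \<alpha> u) (at u)"
    by (simp add: kanter_log_deriv_def cot_def power2_eq_square mult_ac)
  then show "((\<lambda>u. exp (?L u)) has_real_derivative kanter_a \<alpha> u * kanter_log_deriv \<alpha> u) (at u)"
    unfolding kanter_a_eq_exp[OF u] by (rule DERIV_fun_exp)
qed (use u in \<open>auto simp: kanter_a_eq_exp\<close>)

text \<open>Since x cot x decreases, c cot (c u) > cot u for c = \<alpha> and for c = 1 - \<alpha>.
  These two inequalities are averaged with the weights \<alpha> and 1 - \<alpha>, which sum to
  1.\<close>

lemma kanter_log_deriv_pos:
  assumes u: "0 < u" "u < pi"
  shows "kanter_log_deriv \<alpha> u > 0"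
proof -
  note b = scaled_bounds[OF u]
  have "u * cot u < (\<alpha> * u) * cot (\<alpha> * u)" "u * cot u < ((1 - \<alpha>) * u) * cot ((1 - \<alpha>) * u)"
    by (rule x_cot_x_strict_antimono; use u b in simp)+
  then have "cot u < \<alpha> * cot (\<alpha> * u)" "cot u < (1 - \<alpha>) * cot ((1 - \<alpha>) * u)"
    using u by (simp_all add: mult.assoc mult.left_commute[of _ u])
  then have "\<alpha> * cot u + (1 - \<alpha>) * cot u <
      \<alpha> * (\<alpha> * cot (\<alpha> * u)) + (1 - \<alpha>) * ((1 - \<alpha>) * cot ((1 - \<alpha>) * u))"
    using \<alpha> by (intro add_strict_mono mult_strict_left_mono) auto
  then show ?thesis
    using \<alpha> by (simp add: kanter_log_deriv_def power2_eq_square algebra_simps)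
qed

lemma kanter_a_pos: "0 < u \<Longrightarrow> u < pi \<Longrightarrow> kanter_a \<alpha> u > 0"
  by (simp add: kanter_a_eq_exp)

lemma isCont_kanter_a: "0 < u \<Longrightarrow> u < pi \<Longrightarrow> isCont (kanter_a \<alpha>) u"
  using DERIV_kanter_a DERIV_isCont by blast

lemma kanter_a_strict_mono:
  assumes "0 < x" "x < y" "y < pi"
  shows "kanter_a \<alpha> x < kanter_a \<alpha> y"
proof (rule DERIV_pos_imp_increasing[OF \<open>x < y\<close>])
  fix t assume "x \<le> t" "t \<le> y"
  then have "0 < t" "t < pi" using assms by auto
  then show "\<exists>d. (kanter_a \<alpha> has_real_derivative d) (at t) \<and> 0 < d"
    using DERIV_kanter_a kanter_a_pos kanter_log_deriv_pos by (meson mult_pos_pos)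
qed

lemma kanter_a_le_iff:
  assumes "0 < x" "x < pi" "0 < y" "y < pi"
  shows "kanter_a \<alpha> x \<le> kanter_a \<alpha> y \<longleftrightarrow> x \<le> y"
  using kanter_a_strict_mono[of x y] kanter_a_strict_mono[of y x] assms
  by (cases x y rule: linorder_cases) auto

lemma inj_on_kanter_a: "inj_on (kanter_a \<alpha>) {0<..<pi}"
  using kanter_a_le_iff by (intro inj_onI) (metis antisym greaterThanLessThan_iff order_refl)

lemma tendsto_kanter_a_0: "(kanter_a \<alpha> \<longlongrightarrow> kanter_a0 \<alpha>) (at_right 0)"
proof -
  have lim: "((\<lambda>u. kanter_c c u) \<longlongrightarrow> c) (at_right 0)" if "c > 0" for c
    unfolding kanter_c_def using that by real_asymp
  have "((\<lambda>u. kanter_c \<alpha> u powr (\<alpha> / (1 - \<alpha>)) * kanter_c (1 - \<alpha>) u) \<longlongrightarrow>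
      \<alpha> powr (\<alpha> / (1 - \<alpha>)) * (1 - \<alpha>)) (at_right 0)"
    using \<alpha> by (intro tendsto_intros lim) auto
  moreover have "\<forall>\<^sub>F u in at_right 0.
      kanter_c \<alpha> u powr (\<alpha> / (1 - \<alpha>)) * kanter_c (1 - \<alpha>) u = kanter_a \<alpha> u"
    using eventually_at_right_real[OF pi_gt_zero] by eventually_elim (simp add: kanter_a_eq_prod)
  ultimately show ?thesis
    unfolding kanter_a0_def by (simp add: mult.commute tendsto_cong)
qed

text \<open>Both \<alpha> pi and (1 - \<alpha>) pi lie strictly inside (0, pi), so the numerator of
  \<open>kanter_b\<close> has a positive limit while sin u tends to 0 from above.\<close>

lemma filterlim_kanter_a_pi: "filterlim (kanter_a \<alpha>) at_top (at_left pi)"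
proof -
  have "filterlim (\<lambda>u. kanter_b \<alpha> u) at_top (at_left pi)"
  proof (rule filterlim_cong[THEN iffD1, OF refl refl])
    show "\<forall>\<^sub>F u in at_left pi.
        sin (\<alpha> * u) powr \<alpha> * sin ((1 - \<alpha>) * u) powr (1 - \<alpha>) / sin u = kanter_b \<alpha> u"
      using eventually_at_left_real[OF pi_gt_zero] by eventually_elim (simp add: kanter_b_eq)
    have pos: "sin (\<alpha> * pi) > 0" "sin ((1 - \<alpha>) * pi) > 0"
      using \<alpha> by (auto intro!: sin_gt_zero)
    show "filterlim (\<lambda>u. sin (\<alpha> * u) powr \<alpha> * sin ((1 - \<alpha>) * u) powr (1 - \<alpha>) / sin u)
        at_top (at_left pi)"
      unfolding divide_inverse
    proof (rule filterlim_tendsto_pos_mult_at_top)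
      show "((\<lambda>u. sin (\<alpha> * u) powr \<alpha> * sin ((1 - \<alpha>) * u) powr (1 - \<alpha>)) \<longlongrightarrow>
          sin (\<alpha> * pi) powr \<alpha> * sin ((1 - \<alpha>) * pi) powr (1 - \<alpha>)) (at_left pi)"
        using pos by (intro tendsto_intros) auto
      show "filterlim (\<lambda>u. inverse (sin u)) at_top (at_left pi)"
        by real_asymp
    qed (use pos in auto)
  qed
  then show ?thesis
    unfolding kanter_a_def [abs_def] using \<alpha>
    by (intro filterlim_compose[OF _ \<open>filterlim (kanter_b \<alpha>) at_top (at_left pi)\<close>,
          of "\<lambda>x. x powr (1 / (1 - \<alpha>))"]) real_asymp
qed

lemma kanter_a_gt_a0:
  assumes "0 < u" "u < pi"
  shows "kanter_a0 \<alpha> < kanter_a \<alpha> u"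
proof -
  \<comment> \<open>Passing to the limit gives only a weak inequality; comparing u / 2 with u
    restores strictness.\<close>
  have "kanter_a0 \<alpha> \<le> kanter_a \<alpha> (u / 2)"
  proof (rule tendsto_upperbound[OF tendsto_kanter_a_0])
    show "\<forall>\<^sub>F x in at_right 0. kanter_a \<alpha> x \<le> kanter_a \<alpha> (u / 2)"
      using eventually_at_right_real[of 0 "u / 2"] assms
      by (auto elim!: eventually_mono simp: kanter_a_le_iff)
  qed simp
  also have "\<dots> < kanter_a \<alpha> u" using assms by (intro kanter_a_strict_mono) auto
  finally show ?thesis .
qed

lemma kanter_a_surj:
  assumes "kanter_a0 \<alpha> < y"
  obtains u where "0 < u" "u < pi" "kanter_a \<alpha> u = y"
proof -
  have "\<forall>\<^sub>F x in at_right 0. kanter_a \<alpha> x < y \<and> x \<in> {0<..<pi}"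
    using order_tendstoD(2)[OF tendsto_kanter_a_0 assms] eventually_at_right_real[OF pi_gt_zero]
    by eventually_elim auto
  from eventually_happens'[OF trivial_limit_at_right_real this]
  obtain p where p: "0 < p" "p < pi" "kanter_a \<alpha> p < y"
    by auto
  have "\<forall>\<^sub>F x in at_left pi. y < kanter_a \<alpha> x \<and> x \<in> {0<..<pi}"
    using filterlim_kanter_a_pi[unfolded filterlim_at_top_dense, rule_format, of y]
      eventually_at_left_real[OF pi_gt_zero]
    by eventually_elim auto
  from eventually_happens'[OF trivial_limit_at_left_real this]
  obtain q where q: "0 < q" "q < pi" "y < kanter_a \<alpha> q"
    by auto
  have "p \<le> q" using kanter_a_le_iff[of p q] p q by simp
  moreover have "\<forall>x. p \<le> x \<and> x \<le> q \<longrightarrow> isCont (kanter_a \<alpha>) x"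
    using p q isCont_kanter_a by auto
  ultimately obtain u where "p \<le> u" "u \<le> q" "kanter_a \<alpha> u = y"
    using IVT[of "kanter_a \<alpha>" p y q] p q by auto
  then show ?thesis using that[of u] p q by auto
qed

section \<open>The inverse function and the density formula\<close>

lemma kanter_a_inv_a: "0 < u \<Longrightarrow> u < pi \<Longrightarrow> kanter_a_inv \<alpha> (kanter_a \<alpha> u) = u"
  unfolding kanter_a_inv_def by (rule the_inv_into_f_f[OF inj_on_kanter_a]) auto

lemma kanter_a_inv:
  assumes "kanter_a0 \<alpha> < y"
  shows "0 < kanter_a_inv \<alpha> y" "kanter_a_inv \<alpha> y < pi" "kanter_a \<alpha> (kanter_a_inv \<alpha> y) = y"
proof -
  obtain u where "0 < u" "u < pi" "kanter_a \<alpha> u = y" using kanter_a_surj[OF assms] .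
  then show "0 < kanter_a_inv \<alpha> y" "kanter_a_inv \<alpha> y < pi" "kanter_a \<alpha> (kanter_a_inv \<alpha> y) = y"
    using kanter_a_inv_a by auto
qed

text \<open>This turns the event that \<open>kanter_a \<alpha> (U \<omega>)\<close> is at most y
  into an interval condition on U.\<close>

lemma kanter_a_le_iff_le_inv:
  assumes "kanter_a0 \<alpha> < y" "0 < u" "u < pi"
  shows "kanter_a \<alpha> u \<le> y \<longleftrightarrow> u \<le> kanter_a_inv \<alpha> y"
  using kanter_a_inv[OF assms(1)] kanter_a_le_iff assms by metis

lemma kanter_a0_pos: "kanter_a0 \<alpha> > 0"
  using \<alpha> by (simp add: kanter_a0_def)

lemma isCont_kanter_a_inv:
  assumes "kanter_a0 \<alpha> < y"
  shows "isCont (kanter_a_inv \<alpha>) y"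
proof -
  define u where "u = kanter_a_inv \<alpha> y"
  have u: "0 < u" "u < pi" "kanter_a \<alpha> u = y"
    using kanter_a_inv[OF assms] by (auto simp: u_def)
  have "isCont (kanter_a_inv \<alpha>) (kanter_a \<alpha> u)"
    \<comment> \<open>The midpoints of (0, u) and (u, pi) give a closed interval around u that stays
      inside (0, pi).\<close>
    by (rule isCont_inverse_function2[of "u / 2" u "(u + pi) / 2"])
      (use u in \<open>auto intro!: kanter_a_inv_a isCont_kanter_a\<close>)
  then show ?thesis by (simp add: u)
qed

lemma DERIV_kanter_a_inv:
  assumes y: "kanter_a0 \<alpha> < y"
  shows "(kanter_a_inv \<alpha> has_real_derivative
    inverse (y * kanter_log_deriv \<alpha> (kanter_a_inv \<alpha> y))) (at y)"
proof (rule DERIV_inverse_function[where f = "kanter_a \<alpha>" and a = "kanter_a0 \<alpha>" and b = "y + 1"])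
  note inv = kanter_a_inv[OF y]
  show "(kanter_a \<alpha> has_real_derivative y * kanter_log_deriv \<alpha> (kanter_a_inv \<alpha> y))
      (at (kanter_a_inv \<alpha> y))"
    using DERIV_kanter_a[OF inv(1,2)] inv by simp
  show "y * kanter_log_deriv \<alpha> (kanter_a_inv \<alpha> y) \<noteq> 0"
    using kanter_log_deriv_pos[OF inv(1,2)] kanter_a0_pos y by simp
qed (use y kanter_a_inv isCont_kanter_a_inv in auto)

lemma kanter_h_eq:
  assumes "kanter_a0 \<alpha> < y"
  shows "kanter_h \<alpha> y = inverse (y * kanter_log_deriv \<alpha> (kanter_a_inv \<alpha> y)) / pi"
  using DERIV_imp_deriv[OF DERIV_kanter_a_inv[OF assms]] assms by (simp add: kanter_h_def)

lemma kanter_h_nonneg: "kanter_h \<alpha> y \<ge> 0"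
proof (cases "kanter_a0 \<alpha> < y")
  case True
  then show ?thesis
    using kanter_log_deriv_pos[of "kanter_a_inv \<alpha> y"] kanter_a_inv[of y] kanter_a0_pos
    by (simp add: kanter_h_eq)
qed (simp add: kanter_h_def)

lemma continuous_on_kanter_h: "continuous_on {kanter_a0 \<alpha><..} (kanter_h \<alpha>)"
proof -
  have inv: "continuous_on {kanter_a0 \<alpha><..} (kanter_a_inv \<alpha>)"
    by (auto intro!: continuous_at_imp_continuous_on isCont_kanter_a_inv)
  have nz: "sin (kanter_a_inv \<alpha> y) \<noteq> 0" "sin (\<alpha> * kanter_a_inv \<alpha> y) \<noteq> 0"
    "sin ((1 - \<alpha>) * kanter_a_inv \<alpha> y) \<noteq> 0" "y * kanter_log_deriv \<alpha> (kanter_a_inv \<alpha> y) \<noteq> 0"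
    if "kanter_a0 \<alpha> < y" for y
    using sin_scaled_pos[of "kanter_a_inv \<alpha> y"] kanter_a_inv[OF that]
      kanter_log_deriv_pos[of "kanter_a_inv \<alpha> y"] kanter_a0_pos that by auto
  have "continuous_on {kanter_a0 \<alpha><..} (\<lambda>y. kanter_log_deriv \<alpha> (kanter_a_inv \<alpha> y))"
    unfolding kanter_log_deriv_def using nz \<alpha>
    by (intro continuous_intros inv) auto
  then have "continuous_on {kanter_a0 \<alpha><..}
      (\<lambda>y. inverse (y * kanter_log_deriv \<alpha> (kanter_a_inv \<alpha> y)) / pi)"
    using nz by (intro continuous_intros) auto
  then show ?thesis
    by (rule continuous_on_eq) (simp add: kanter_h_eq)
qed

section \<open>Measurability and the law of \<open>kanter_a \<alpha> (U \<omega>)\<close>\<close>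

lemma borel_measurable_kanter_h [measurable]: "kanter_h \<alpha> \<in> borel_measurable borel"
proof -
  have "(\<lambda>y. if y \<in> {kanter_a0 \<alpha><..} then kanter_h \<alpha> y else 0) \<in> borel_measurable borel"
    by (intro borel_measurable_continuous_on_if continuous_on_kanter_h) auto
  also have "(\<lambda>y. if y \<in> {kanter_a0 \<alpha><..} then kanter_h \<alpha> y else 0) = kanter_h \<alpha>"
    by (auto simp: kanter_h_def)
  finally show ?thesis .
qed

lemma borel_measurable_kanter_a [measurable]: "kanter_a \<alpha> \<in> borel_measurable borel"
  unfolding kanter_a_def [abs_def] kanter_b_def kanter_c_def by measurable

lemma kanter_a_inv_image:
  assumes "kanter_a0 \<alpha> < y"
  shows "kanter_a_inv \<alpha> ` {kanter_a0 \<alpha><..y} = {0<..kanter_a_inv \<alpha> y}"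
proof (intro equalityI subsetI)
  fix u assume "u \<in> {0<..kanter_a_inv \<alpha> y}"
  then have u: "0 < u" "u < pi" "u \<le> kanter_a_inv \<alpha> y" using kanter_a_inv[OF assms] by auto
  then have "kanter_a \<alpha> u \<in> {kanter_a0 \<alpha><..y}"
    using kanter_a_gt_a0 kanter_a_le_iff_le_inv[OF assms] by auto
  then show "u \<in> kanter_a_inv \<alpha> ` {kanter_a0 \<alpha><..y}"
    using kanter_a_inv_a[of u] u by (metis imageI)
next
  fix u assume "u \<in> kanter_a_inv \<alpha> ` {kanter_a0 \<alpha><..y}"
  then obtain x where x: "u = kanter_a_inv \<alpha> x" "kanter_a0 \<alpha> < x" "x \<le> y" by auto
  then show "u \<in> {0<..kanter_a_inv \<alpha> y}"
    using kanter_a_inv[of x] kanter_a_le_iff_le_inv[OF assms, of u] by simp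
qed

text \<open>The substitution u = \<open>kanter_a_inv \<alpha> x\<close> has Jacobian
  \<open>pi * kanter_h \<alpha> x\<close>, so the integral becomes that of the constant 1 / pi over
  the image interval given by \<open>kanter_a_inv_image\<close>.\<close>

lemma nn_integral_kanter_h:
  assumes y: "kanter_a0 \<alpha> < y"
  shows "(\<integral>\<^sup>+x. ennreal (kanter_h \<alpha> x) * indicator {..y} x \<partial>lborel) =
    ennreal (kanter_a_inv \<alpha> y / pi)"
proof -
  let ?S = "{kanter_a0 \<alpha><..y}"
  have inj: "inj_on (kanter_a_inv \<alpha>) ?S"
    using kanter_a_inv(3) by (metis greaterThanAtMost_iff inj_onI)
  have der: "(kanter_a_inv \<alpha> has_real_derivative pi * kanter_h \<alpha> x) (at x within ?S)"
    if "x \<in> ?S" for x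
    using DERIV_kanter_a_inv[of x] that by (auto simp: kanter_h_eq intro: DERIV_subset)
  let ?T = "{0<..kanter_a_inv \<alpha> y}"
  have T: "?T \<in> lmeasurable" by (rule bounded_set_imp_lmeasurable) auto
  have "measure lebesgue ?T = kanter_a_inv \<alpha> y"
    using kanter_a_inv(1)[OF y] by simp
  then have "integral ?T (\<lambda>_. 1) = kanter_a_inv \<alpha> y"
    using lmeasure_integral[OF T] by simp
  then have "(\<lambda>_. 1 / pi) absolutely_integrable_on ?T \<and>
      integral ?T (\<lambda>_. 1 / pi) = kanter_a_inv \<alpha> y / pi"
    using absolutely_integrable_on_const[OF T] integral_divide[of ?T "\<lambda>_. 1" pi] by simp
  then have "(\<lambda>x. \<bar>pi * kanter_h \<alpha> x\<bar> * (1 / pi)) absolutely_integrable_on ?S \<and>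
      integral ?S (\<lambda>x. \<bar>pi * kanter_h \<alpha> x\<bar> * (1 / pi)) = kanter_a_inv \<alpha> y / pi"
    using has_absolute_integral_change_of_variables_1'[OF _ der inj,
        of "\<lambda>_. 1 / pi" "kanter_a_inv \<alpha> y / pi"] kanter_a_inv_image[OF y] by simp
  then have "(kanter_h \<alpha> has_integral kanter_a_inv \<alpha> y / pi) ?S"
    using kanter_h_nonneg set_lebesgue_integral_eq_integral(1)
    by (auto simp: has_integral_iff abs_mult)
  then have "(\<integral>\<^sup>+x. ennreal (kanter_h \<alpha> x) * indicator ?S x \<partial>lborel) = ennreal (kanter_a_inv \<alpha> y / pi)"
    using kanter_h_nonneg by (intro nn_integral_has_integral_lebesgue') auto
  \<comment> \<open>The extension of \<open>kanter_h\<close> by 0 allows the domain to grow to all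
    of \<open>{..y}\<close>.\<close>
  also have "(\<integral>\<^sup>+x. ennreal (kanter_h \<alpha> x) * indicator ?S x \<partial>lborel) =
      (\<integral>\<^sup>+x. ennreal (kanter_h \<alpha> x) * indicator {..y} x \<partial>lborel)"
    by (intro nn_integral_cong) (auto simp: kanter_h_def indicator_def)
  finally show ?thesis .
qed

text \<open>The distribution function and the integral of \<open>kanter_h\<close> up to y are both
  computed, and both equal \<open>?g y\<close>.\<close>

lemma distributed_kanter_a:
  assumes "uniform_0_pi M U"
  shows "distributed M lborel (\<lambda>\<omega>. kanter_a \<alpha> (U \<omega>)) (\<lambda>y. ennreal (kanter_h \<alpha> y))"
proof -
  have U: "distributed M lborel U (\<lambda>u. ennreal (indicator {0<..<pi} u / pi))"
    using assms by (simp add: uniform_0_pi_def)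
  then have [measurable]: "U \<in> borel_measurable M" by (auto dest: distributed_measurable)
  let ?g = "\<lambda>y. if kanter_a0 \<alpha> < y then kanter_a_inv \<alpha> y / pi else 0"
  show ?thesis
  proof (rule distributedI_borel_atMost[where g = ?g])
    fix y
    have "(\<integral>\<^sup>+x. ennreal (kanter_h \<alpha> x) * indicator {..y} x \<partial>lborel) = ennreal (?g y)"
    proof (cases "kanter_a0 \<alpha> < y")
      case False
      then have "(\<integral>\<^sup>+x. ennreal (kanter_h \<alpha> x) * indicator {..y} x \<partial>lborel) = (\<integral>\<^sup>+(x::real). 0 \<partial>lborel)"
        by (intro nn_integral_cong) (auto simp: kanter_h_def indicator_def)
      then show ?thesis using False by simp
    qed (simp add: nn_integral_kanter_h)
    then show "(\<integral>\<^sup>+x. ennreal (kanter_h \<alpha> x * indicator {..y} x) \<partial>lborel) = ennreal (?g y)"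
      by (simp only: nn_integral_set_ennreal)
    \<comment> \<open>\<open>?V\<close> is the part of (0, pi) on which
      \<open>kanter_a \<alpha>\<close> is at most y: empty for y \<le>
      \<open>kanter_a0 \<alpha>\<close>, and otherwise bounded by a point strictly below pi.\<close>
    let ?V = "if kanter_a0 \<alpha> < y then {0<..kanter_a_inv \<alpha> y} else {}"
    have "emeasure M {\<omega> \<in> space M. kanter_a \<alpha> (U \<omega>) \<le> y} =
        emeasure M (U -` {u. kanter_a \<alpha> u \<le> y} \<inter> space M)"
      by (intro arg_cong2[where f = emeasure]) auto
    also have "\<dots> = (\<integral>\<^sup>+u. ennreal (indicator {0<..<pi} u / pi) *
        indicator {u. kanter_a \<alpha> u \<le> y} u \<partial>lborel)"
      by (rule distributed_emeasure[OF U]) measurable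
    also have "\<dots> = (\<integral>\<^sup>+u. ennreal (1 / pi) * indicator ?V u \<partial>lborel)"
    proof (intro nn_integral_cong)
      fix u
      have "0 < u \<and> u < pi \<and> kanter_a \<alpha> u \<le> y \<longleftrightarrow> u \<in> ?V"
      proof (cases "kanter_a0 \<alpha> < y")
        case True
        then show ?thesis
          using kanter_a_le_iff_le_inv[of y u] kanter_a_inv(2)[of y] by auto
      next
        case False
        then show ?thesis using kanter_a_gt_a0[of u] by auto
      qed
      then show "ennreal (indicator {0<..<pi} u / pi) * indicator {u. kanter_a \<alpha> u \<le> y} u =
          ennreal (1 / pi) * indicator ?V u"
        by (auto simp: indicator_def split: if_splits)
    qed
    also have "\<dots> = ennreal (1 / pi) * emeasure lborel ?V"
      by (simp add: nn_integral_cmult)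
    also have "\<dots> = ennreal (?g y)"
    proof (cases "kanter_a0 \<alpha> < y")
      case True
      then have "emeasure lborel ?V = ennreal (kanter_a_inv \<alpha> y)"
        using kanter_a_inv(1)[of y] by simp
      then show ?thesis
        using True kanter_a_inv(1)[of y] by (simp add: ennreal_mult[symmetric])
    qed simp
    finally show "emeasure M {\<omega> \<in> space M. kanter_a \<alpha> (U \<omega>) \<le> y} = ennreal (?g y)" .
  qed (use kanter_h_nonneg in auto)
qed

section \<open>Bounding the density for small \<alpha> and u near pi\<close>

text \<open>Put \<open>\<beta> = 1 - \<alpha>\<close>. The equation \<open>kanter_b \<alpha> u = y powr \<beta>\<close> reads
  \<open>sin (\<beta> u) / sin u = y powr \<beta> * (sin (\<beta> u) / sin (\<alpha> u)) powr \<alpha>\<close>, whose last factor is at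
  least 1 as soon as \<open>\<alpha> u \<le> \<pi> - \<beta> u \<le> \<pi> / 2\<close>.\<close>

lemma sin_ratio_ge:
  assumes u: "2 * pi / 3 \<le> u" "u < pi" and small: "\<alpha> \<le> 1 / 4"
  shows "kanter_a \<alpha> u powr (1 - \<alpha>) * sin u \<le> sin ((1 - \<alpha>) * u)"
proof -
  have u0: "0 < u" using u pi_gt_zero by linarith
  note s = sin_scaled_pos[OF u0 u(2)]
  have "1 / 4 * pi \<ge> \<alpha> * u" using small \<alpha> u u0 by (intro mult_mono) auto
  \<comment> \<open>The thresholds 1/4 and 2 pi / 3 are matched: 3/4 times 2 pi / 3 is exactly pi /
    2. The second inequality derived next is just u \<le> pi rearranged.\<close>
  have "(1 - \<alpha>) * u \<ge> 3 / 4 * (2 * pi / 3)" using small u by (intro mult_mono) auto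
  then have w: "pi - (1 - \<alpha>) * u \<le> pi / 2" "\<alpha> * u \<le> pi - (1 - \<alpha>) * u"
    using u by (auto simp: algebra_simps)
  have "sin (\<alpha> * u) \<le> sin (pi - (1 - \<alpha>) * u)"
    using w scaled_bounds[OF u0 u(2)] by (intro sin_monotone_2pi_le) linarith+
  then have le: "sin (\<alpha> * u) \<le> sin ((1 - \<alpha>) * u)" by (simp add: sin_diff cos_pi sin_pi)
  have "kanter_a \<alpha> u powr (1 - \<alpha>) = kanter_b \<alpha> u"
    using \<alpha> s by (simp add: kanter_a_def powr_powr kanter_b_eq[OF u0 u(2)])
  then have "kanter_a \<alpha> u powr (1 - \<alpha>) * sin u =
      sin (\<alpha> * u) powr \<alpha> * sin ((1 - \<alpha>) * u) powr (1 - \<alpha>)"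
    using s by (simp add: kanter_b_eq[OF u0 u(2)])
  also have "\<dots> \<le> sin ((1 - \<alpha>) * u) powr \<alpha> * sin ((1 - \<alpha>) * u) powr (1 - \<alpha>)"
    using le s \<alpha> by (intro mult_right_mono powr_mono2) auto
  also have "\<dots> = sin ((1 - \<alpha>) * u)"
    using s by (simp flip: powr_add)
  finally show ?thesis .
qed

lemma kanter_log_deriv_ge:
  assumes u: "2 * pi / 3 \<le> u" "u < pi" and small: "\<alpha> \<le> 1 / 4"
  shows "1 / sin u - 1 / sin ((1 - \<alpha>) * u) \<le> (1 - \<alpha>) * kanter_log_deriv \<alpha> u"
proof -
  have u0: "0 < u" using u pi_gt_zero by linarith
  note s = sin_scaled_pos[OF u0 u(2)] and b = scaled_bounds[OF u0 u(2)]
  have "\<alpha> * u \<le> 1 / 4 * pi" using small \<alpha> u u0 by (intro mult_mono) auto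
  then have "cos (\<alpha> * u) \<ge> 0" using b pi_gt_zero by (intro cos_ge_zero) linarith+
  then have c1: "cot (\<alpha> * u) \<ge> 0" using s by (simp add: cot_def)
  have "(1 - \<alpha>) * u \<ge> 3 / 4 * (2 * pi / 3)" using small u by (intro mult_mono) auto
  then have "cos (pi - (1 - \<alpha>) * u) \<ge> 0" using b by (intro cos_ge_zero) linarith+
  then have "cos ((1 - \<alpha>) * u) \<le> 0" by (simp add: cos_diff)
  then have c2: "cot ((1 - \<alpha>) * u) \<le> 0" using s by (simp add: cot_def divide_nonpos_pos)
  have "(1 - \<alpha>)\<^sup>2 \<le> 1" using \<alpha> by (simp add: power_le_one)
  then have c3: "cot ((1 - \<alpha>) * u) \<le> (1 - \<alpha>)\<^sup>2 * cot ((1 - \<alpha>) * u)"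
    using c2 mult_right_mono_neg by fastforce
  \<comment> \<open>Expand the sine of u - \<alpha> u and bound both cos (\<alpha> u) and - cos u by
    1.\<close>
  have "sin ((1 - \<alpha>) * u) = sin u * cos (\<alpha> * u) + (- cos u) * sin (\<alpha> * u)"
    by (simp add: left_diff_distrib sin_diff)
  also have "\<dots> \<le> sin u * 1 + 1 * sin (\<alpha> * u)"
    using s by (intro add_mono mult_left_mono mult_right_mono) (auto simp: minus_le_iff)
  finally have "sin ((1 - \<alpha>) * u) - sin u \<le> sin (\<alpha> * u)" by simp
  then have "(sin ((1 - \<alpha>) * u) - sin u) / (sin ((1 - \<alpha>) * u) * sin u) \<le>
      sin (u - (1 - \<alpha>) * u) / (sin ((1 - \<alpha>) * u) * sin u)"
    using s by (intro divide_right_mono) (auto simp: left_diff_distrib)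
  also have "\<dots> = cot ((1 - \<alpha>) * u) - cot u"
    using s by (intro cot_diff[symmetric]) auto
  also have "\<dots> \<le> \<alpha>\<^sup>2 * cot (\<alpha> * u) + (1 - \<alpha>)\<^sup>2 * cot ((1 - \<alpha>) * u) - cot u"
    using c1 c3 by (simp add: add_increasing)
  also have "\<dots> = (1 - \<alpha>) * kanter_log_deriv \<alpha> u"
    using \<alpha> by (simp add: kanter_log_deriv_def)
  finally show ?thesis
    using s by (simp add: diff_divide_distrib)
qed

lemma kanter_h_le:
  assumes y: "1 < y" "kanter_a0 \<alpha> < y" and small: "\<alpha> \<le> 1 / 4"
    and u: "2 * pi / 3 \<le> kanter_a_inv \<alpha> y"
  shows "kanter_h \<alpha> y \<le> sin (kanter_a_inv \<alpha> y) / (1 - y powr (\<alpha> - 1))"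
proof -
  define u where "u = kanter_a_inv \<alpha> y"
  define p where "p = y powr (\<alpha> - 1)"
  note inv = kanter_a_inv[OF y(2), folded u_def]
  note s = sin_scaled_pos[OF inv(1,2)]
  have p: "0 < p" "p < 1" "y powr (1 - \<alpha>) = 1 / p"
    using y \<alpha> powr_less_mono[of "\<alpha> - 1" 0 y] powr_minus_divide[of y "\<alpha> - 1"]
    by (auto simp: p_def)
  \<comment> \<open>With \<open>kanter_a \<alpha> u\<close> equal to y, the sine ratio bound becomes
    a comparison of the two reciprocal sines with the factor p < 1.\<close>
  have "1 / p * sin u \<le> sin ((1 - \<alpha>) * u)"
    using sin_ratio_ge[OF _ inv(2) small] assms(4) inv(3) p by (simp add: u_def)
  then have "1 / sin ((1 - \<alpha>) * u) \<le> p / sin u"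
    using s p by (simp add: field_simps)
  then have "(1 - p) / sin u \<le> 1 / sin u - 1 / sin ((1 - \<alpha>) * u)"
    by (simp add: diff_divide_distrib)
  also have "\<dots> \<le> (1 - \<alpha>) * kanter_log_deriv \<alpha> u"
    using kanter_log_deriv_ge[OF _ inv(2) small] assms(4) by (simp add: u_def)
  \<comment> \<open>The factors 1 - \<alpha> and pi y may be treated crudely: the decay comes from
    sin u alone.\<close>
  also have "\<dots> \<le> 1 * kanter_log_deriv \<alpha> u"
    using \<alpha> kanter_log_deriv_pos[OF inv(1,2)] by (intro mult_right_mono) auto
  also have "\<dots> \<le> (pi * y) * kanter_log_deriv \<alpha> u"
    using y kanter_log_deriv_pos[OF inv(1,2)] pi_ge_two mult_mono[of 1 pi 1 y]
    by (intro mult_right_mono) auto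
  finally have "inverse ((pi * y) * kanter_log_deriv \<alpha> u) \<le> inverse ((1 - p) / sin u)"
    using p s by (intro le_imp_inverse_le) auto
  then show ?thesis
    by (simp add: kanter_h_eq[OF y(2)] u_def p_def field_simps)
qed

end

section \<open>The limit as \<alpha> tends to 0\<close>

lemma tendsto_kanter_a_1:
  assumes u: "0 < u" "u < pi"
  shows "((\<lambda>\<alpha>. kanter_a \<alpha> u) \<longlongrightarrow> 1) (at_right 0)"
proof -
  have s: "sin u > 0" using u by (rule sin_gt_zero)
  \<comment> \<open>The base vanishes linearly in \<alpha> and the exponent is asymptotic to
    \<alpha>, so the power tends to 1 as \<open>\<alpha> powr \<alpha>\<close> does.\<close>
  have "((\<lambda>\<alpha>. (sin (\<alpha> * u) / sin u) powr (\<alpha> / (1 - \<alpha>))) \<longlongrightarrow> 1) (at_right 0)"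
    using u s by real_asymp
  moreover have "((\<lambda>\<alpha>. sin ((1 - \<alpha>) * u) / sin u) \<longlongrightarrow> sin ((1 - 0) * u) / sin u) (at_right 0)"
    using s by (intro tendsto_intros) auto
  ultimately have "((\<lambda>\<alpha>. kanter_c \<alpha> u powr (\<alpha> / (1 - \<alpha>)) * kanter_c (1 - \<alpha>) u) \<longlongrightarrow> 1) (at_right 0)"
    unfolding kanter_c_def using s tendsto_mult by fastforce
  moreover have "\<forall>\<^sub>F \<alpha> in at_right 0.
      kanter_c \<alpha> u powr (\<alpha> / (1 - \<alpha>)) * kanter_c (1 - \<alpha>) u = kanter_a \<alpha> u"
    using eventually_at_right_real[OF zero_less_one]
    by eventually_elim (simp add: kanter_a_eq_prod u)
  ultimately show ?thesis by (simp add: tendsto_cong)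
qed

text \<open>At the fixed point u the values \<open>kanter_a \<alpha> u\<close> tend to 1 < y, so
  they eventually lie below y. Monotonicity then places u to the left of the solution, and
  \<open>kanter_a0 \<alpha>\<close>, being smaller than these values, also lies below y.\<close>

lemma eventually_kanter_a_inv_gt:
  assumes y: "1 < y" and u: "0 < u" "u < pi"
  shows "\<forall>\<^sub>F \<alpha> in at_right 0. kanter_a0 \<alpha> < y \<and> u < kanter_a_inv \<alpha> y"
  using order_tendstoD(2)[OF tendsto_kanter_a_1[OF u] y] eventually_at_right_real[OF zero_less_one]
proof eventually_elim
  case (elim \<alpha>)
  then have \<alpha>: "0 < \<alpha>" "\<alpha> < 1" by auto
  have "kanter_a0 \<alpha> < y" using kanter_a_gt_a0[OF \<alpha> u] elim by simp
  moreover have "u < kanter_a_inv \<alpha> y"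
    using kanter_a_inv[OF \<alpha> calculation] kanter_a_le_iff[OF \<alpha>, of "kanter_a_inv \<alpha> y" u] elim u
    by fastforce
  ultimately show ?case by blast
qed

lemma tendsto_kanter_a_inv:
  assumes "1 < y"
  shows "((\<lambda>\<alpha>. kanter_a_inv \<alpha> y) \<longlongrightarrow> pi) (at_right 0)"
proof (rule order_tendstoI)
  fix a :: real assume "a < pi"
  \<comment> \<open>The bound a may be nonpositive; the maximum with 1 moves it into (0,
    pi).\<close>
  then have "0 < max a 1" "max a 1 < pi" using pi_gt3 by auto
  from eventually_kanter_a_inv_gt[OF assms this]
  show "\<forall>\<^sub>F \<alpha> in at_right 0. a < kanter_a_inv \<alpha> y" by eventually_elim auto
next
  fix a :: real assume "pi < a"
  \<comment> \<open>The point 1 is an arbitrary element of (0, pi); only the bound on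
    \<open>kanter_a0\<close> is extracted.\<close>
  from eventually_kanter_a_inv_gt[OF assms, of 1] pi_gt3
  have "\<forall>\<^sub>F \<alpha> in at_right 0. kanter_a0 \<alpha> < y" by (auto elim: eventually_mono)
  with eventually_at_right_real[OF zero_less_one]
  show "\<forall>\<^sub>F \<alpha> in at_right 0. kanter_a_inv \<alpha> y < a"
  proof eventually_elim
    case (elim \<alpha>)
    then show ?case using kanter_a_inv(2)[of \<alpha> y] \<open>pi < a\<close> by auto
  qed
qed

lemma tendsto_kanter_h:
  assumes y: "1 < y"
  shows "((\<lambda>\<alpha>. kanter_h \<alpha> y) \<longlongrightarrow> 0) (at_right 0)"
proof (rule tendsto_sandwich)
  show "((\<lambda>_. 0) \<longlongrightarrow> (0::real)) (at_right (0::real))" by simp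
  have "((\<lambda>\<alpha>. y powr (\<alpha> - 1)) \<longlongrightarrow> y powr (0 - 1)) (at_right 0)"
    using y by (intro tendsto_intros) auto
  \<comment> \<open>The limiting denominator 1 - 1 / y is positive, so the quotient tends to a
    multiple of sin pi = 0.\<close>
  moreover have "y powr (0 - 1) < 1" using y powr_less_mono[of "-1" 0 y] by simp
  ultimately have lim: "((\<lambda>\<alpha>. sin (kanter_a_inv \<alpha> y) / (1 - y powr (\<alpha> - 1))) \<longlongrightarrow>
      sin pi / (1 - y powr (0 - 1))) (at_right 0)"
    by (intro tendsto_divide tendsto_diff tendsto_const tendsto_sin tendsto_kanter_a_inv y) linarith+
  show "((\<lambda>\<alpha>. sin (kanter_a_inv \<alpha> y) / (1 - y powr (\<alpha> - 1))) \<longlongrightarrow> 0) (at_right 0)"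
    using lim by simp
  have small: "\<forall>\<^sub>F \<alpha> in at_right 0. \<alpha> \<in> {0<..<1 / 4 :: real}"
    by (rule eventually_at_right_real) simp
  then show "\<forall>\<^sub>F \<alpha> in at_right 0. 0 \<le> kanter_h \<alpha> y"
    by eventually_elim (simp add: kanter_h_nonneg)
  have "\<forall>\<^sub>F \<alpha> in at_right 0. kanter_a0 \<alpha> < y \<and> 2 * pi / 3 < kanter_a_inv \<alpha> y"
    by (rule eventually_kanter_a_inv_gt[OF y]) auto
  with small
  show "\<forall>\<^sub>F \<alpha> in at_right 0. kanter_h \<alpha> y \<le> sin (kanter_a_inv \<alpha> y) / (1 - y powr (\<alpha> - 1))"
    by eventually_elim (rule kanter_h_le; use y in simp)
qed

text \<open>The conjuncts before the limit tie \<open>kanter_h\<close> to the law of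
  \<open>kanter_a \<alpha> (U \<omega>)\<close>; continuity removes the freedom to change a density
  on a null set, so that its value at a fixed y is meaningful.\<close>

theorem mainTheorem4:
  shows "(\<forall>\<alpha>. 0 < \<alpha> \<and> \<alpha> < 1 \<longrightarrow>
            (\<forall>(M :: 'a measure) U. uniform_0_pi M U \<longrightarrow>
               distributed M lborel (\<lambda>\<omega>. kanter_a \<alpha> (U \<omega>)) (\<lambda>y. ennreal (kanter_h \<alpha> y))) \<and>
            continuous_on {(1 - \<alpha>) * \<alpha> powr (\<alpha> / (1 - \<alpha>)) <..} (kanter_h \<alpha>) \<and>
            {y. kanter_h \<alpha> y \<noteq> 0} \<subseteq> {(1 - \<alpha>) * \<alpha> powr (\<alpha> / (1 - \<alpha>)) <..}) \<and>
         (\<forall>y>1. ((\<lambda>\<alpha>. kanter_h \<alpha> y) \<longlongrightarrow> 0) (at_right 0))"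
proof (intro conjI allI impI)
  fix \<alpha> :: real assume \<alpha>: "0 < \<alpha> \<and> \<alpha> < 1"
  show "distributed M lborel (\<lambda>\<omega>. kanter_a \<alpha> (U \<omega>)) (\<lambda>y. ennreal (kanter_h \<alpha> y))"
    if "uniform_0_pi M U" for M :: "'a measure" and U
    using distributed_kanter_a \<alpha> that by blast
  show "continuous_on {(1 - \<alpha>) * \<alpha> powr (\<alpha> / (1 - \<alpha>)) <..} (kanter_h \<alpha>)"
    using continuous_on_kanter_h[of \<alpha>] \<alpha> by (simp add: kanter_a0_def)
  show "{y. kanter_h \<alpha> y \<noteq> 0} \<subseteq> {(1 - \<alpha>) * \<alpha> powr (\<alpha> / (1 - \<alpha>)) <..}"
    by (auto simp: kanter_h_def kanter_a0_def split: if_splits)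
qed (rule tendsto_kanter_h)

end
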